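(* 1-$\text{TPTL}^{0,\infty}$ is strictly more expressive than MITL. That is, for every MITL formula $\psi$ there is a closed 1-$\text{TPTL}^{0,\infty}$ formula $\varphi$ with $L(\varphi)=L(\psi)$. Moreover, there is a closed 1-$\text{TPTL}^{0,\infty}$ formula (for example $x.\mathsf{F}(b\wedge\mathsf{F}(b\wedge x\le1))$) whose language is not $L(\psi)$ for any MITL formula $\psi$.
   Context: Timed words over a finite alphabet $\Sigma$ are sequences $(\sigma_1,\tau_1)(\sigma_2,\tau_2)\cdots$ with $\sigma_i\in\Sigma$ and non-decreasing $\tau_i\in\mathbb{R}_{\ge0}$ (infinite ones are non-zeno). $\mathcal{I}_{\mathsf{int}}$ is the set of real intervals with endpoints in $\mathbb{N}\cup\{0,\infty\}$; an interval is punctual if of the form $[c,c]$. Right-sided intervals are $\langle0,u\rangle$ ($u>0$) and left-sided intervals are $\langle l,\infty)$ ($l,u\in\mathbb{Z}_{\ge0}$). MITL (pointwise semantics, future only): $\psi::=a\mid\top\mid\psi\wedge\psi\mid\neg\psi\mid\psi\,\mathsf{U}_I\,\psi$ with $I\in\mathcal{I}_{\mathsf{int}}$ non-punctual. Here $\rho,i\models\psi_1\mathsf{U}_I\psi_2$ iff there is $j>i$ with $\rho,j\models\psi_2$, $\tau_j-\tau_i\in I$, and $\rho,k\models\psi_1$ for all $i<k<j$. $L(\psi)=\{\rho\mid\rho,1\models\psi\}$. TPTL in negation normal form over variables $X$: $\varphi::=a\mid\neg a\mid\top\mid\bot\mid x.\varphi\mid x\in I\mid\varphi\wedge\varphi\mid\varphi\vee\varphi\mid\varphi\mathsf{U}\varphi\mid\mathsf{G}\varphi$.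 The semantics are: $x.\varphi$ stores the current time stamp in $x$; $x\in I$ (i.e. $T-x\in I$) holds at $i$ iff $\tau_i-\nu(x)\in I$; $\varphi_1\mathsf{U}\varphi_2$ holds at $i$ iff some $j>i$ satisfies $\varphi_2$ and all $i<k<j$ satisfy $\varphi_1$; $\mathsf{G}\varphi$ holds at $i$ iff all $j>i$ satisfy $\varphi$; $\mathsf{F}\varphi=\top\mathsf{U}\varphi$. A closed formula has every constraint variable bound by a freeze quantifier; $L(\varphi)=\{\rho\mid\rho,1\models\varphi\}$. A constraint is open if its variable is unbound. A formula is of type $\le$ (resp. $\ge$) if all intervals in its open constraints are right-sided (resp. left-sided). $\text{TPTL}^{0,\infty}$ consists of NNF formulae all of whose subformulae are of type $\le$ or $\ge$. 1-$\text{TPTL}^{0,\infty}$ is its restriction to a single variable.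
   Formalization: Right-sided intervals ⟨0,u⟩ are allowed to have u = 0, so x ∈ [0,0] is permitted; with u > 0 the first claim fails for ¬(⊤ U_{(0,∞)} ⊤), because time stamps may repeat. *)

theory Defs
  imports Complex_Main
begin

section \<open>Timed words\<close>

datatype 'a tword = FinW "('a \<times> real) list" | InfW "nat \<Rightarrow> 'a \<times> real"

text \<open>Positions are counted from 0, so the initial position of a word is 0.\<close>

primrec positions :: "'a tword \<Rightarrow> nat set" where
  "positions (FinW xs) = {..<length xs}"
| "positions (InfW f) = UNIV"

primrec event :: "'a tword \<Rightarrow> nat \<Rightarrow> 'a \<times> real" where
  "event (FinW xs) i = xs ! i"
| "event (InfW f) i = f i"

definition letter :: "'a tword \<Rightarrow> nat \<Rightarrow> 'a" where
  "letter \<rho> i = fst (event \<rho> i)"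

definition stamp :: "'a tword \<Rightarrow> nat \<Rightarrow> real" where
  "stamp \<rho> i = snd (event \<rho> i)"

text \<open>Words are non-empty, since satisfaction is evaluated at their first position. The last
  conjunct is non-zenoness; it concerns infinite words only.\<close>

definition timed_word :: "'a tword \<Rightarrow> bool" where
  "timed_word \<rho> \<longleftrightarrow>
     0 \<in> positions \<rho> \<and>
     (\<forall>i\<in>positions \<rho>. 0 \<le> stamp \<rho> i) \<and>
     (\<forall>i\<in>positions \<rho>. \<forall>j\<in>positions \<rho>. i \<le> j \<longrightarrow> stamp \<rho> i \<le> stamp \<rho> j) \<and>
     (infinite (positions \<rho>) \<longrightarrow> (\<forall>t. \<exists>i\<in>positions \<rho>. t < stamp \<rho> i))"

section \<open>Intervals\<close>

definition right_sided :: "real set \<Rightarrow> bool" where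
  "right_sided I \<longleftrightarrow>
     (\<exists>u::nat. I \<in> {{0..real u}, {0<..real u}, {0..<real u}, {0<..<real u}})"

text \<open>The bound \<open>u = 0\<close> is allowed, so that \<open>[0,0]\<close> is right-sided. It is needed to negate
  \<open>x \<in> (0,\<infinity>)\<close> in negation normal form. As time stamps may be repeated, without it the MITL
  formula \<open>\<not> (\<top> U\<^sub>I \<top>)\<close> with \<open>I = (0,\<infinity>)\<close> would have no equivalent: all other one-sided
  intervals containing 0 contain \<open>[0,1)\<close>, so a closed formula built from them that holds on a
  word with time stamps 0, 0 also holds on the word with the same letters and time stamps
  0, 1/2.\<close>

definition left_sided :: "real set \<Rightarrow> bool" where
  "left_sided I \<longleftrightarrow> (\<exists>l::nat. I \<in> {{real l..}, {real l<..}})"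

definition int_interval :: "real set \<Rightarrow> bool" where
  "int_interval I \<longleftrightarrow>
     (\<exists>l u::nat. I \<in> {{real l..real u}, {real l<..real u}, {real l..<real u}, {real l<..<real u},
                       {real l..}, {real l<..}})"

definition punctual :: "real set \<Rightarrow> bool" where
  "punctual I \<longleftrightarrow> (\<exists>c. I = {c..c})"

section \<open>MITL\<close>

text \<open>The datatype admits arbitrary sets of reals as time constraints; the MITL formulae proper
  are singled out by \<open>mitl_formula\<close>.\<close>

datatype 'a mitl =
    MAtom 'a
  | MTop
  | MAnd "'a mitl" "'a mitl"
  | MNot "'a mitl"
  | MUntil "'a mitl" "real set" "'a mitl"

primrec mitl_formula :: "'a mitl \<Rightarrow> bool" where
  "mitl_formula (MAtom a) \<longleftrightarrow> True"
| "mitl_formula MTop \<longleftrightarrow> True"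
| "mitl_formula (MAnd \<psi>1 \<psi>2) \<longleftrightarrow> mitl_formula \<psi>1 \<and> mitl_formula \<psi>2"
| "mitl_formula (MNot \<psi>) \<longleftrightarrow> mitl_formula \<psi>"
| "mitl_formula (MUntil \<psi>1 I \<psi>2) \<longleftrightarrow>
     int_interval I \<and> \<not> punctual I \<and> mitl_formula \<psi>1 \<and> mitl_formula \<psi>2"

primrec mitl_sat :: "'a tword \<Rightarrow> nat \<Rightarrow> 'a mitl \<Rightarrow> bool" where
  "mitl_sat \<rho> i (MAtom a) \<longleftrightarrow> letter \<rho> i = a"
| "mitl_sat \<rho> i MTop \<longleftrightarrow> True"
| "mitl_sat \<rho> i (MAnd \<psi>1 \<psi>2) \<longleftrightarrow> mitl_sat \<rho> i \<psi>1 \<and> mitl_sat \<rho> i \<psi>2"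
| "mitl_sat \<rho> i (MNot \<psi>) \<longleftrightarrow> \<not> mitl_sat \<rho> i \<psi>"
| "mitl_sat \<rho> i (MUntil \<psi>1 I \<psi>2) \<longleftrightarrow>
     (\<exists>j\<in>positions \<rho>. i < j \<and> mitl_sat \<rho> j \<psi>2 \<and> stamp \<rho> j - stamp \<rho> i \<in> I \<and>
        (\<forall>k. i < k \<and> k < j \<longrightarrow> mitl_sat \<rho> k \<psi>1))"

definition mitl_lang :: "'a mitl \<Rightarrow> 'a tword set" where
  "mitl_lang \<psi> = {\<rho>. timed_word \<rho> \<and> mitl_sat \<rho> 0 \<psi>}"

section \<open>TPTL in negation normal form\<close>

type_synonym var = nat

datatype 'a tptl =
    TAtom 'a
  | TNAtom 'a
  | TTop
  | TBot
  | Freeze var "'a tptl"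
  | Constr var "real set"
  | TAnd "'a tptl" "'a tptl"
  | TOr "'a tptl" "'a tptl"
  | TUntil "'a tptl" "'a tptl"
  | TGlob "'a tptl"

definition TEv :: "'a tptl \<Rightarrow> 'a tptl" where
  "TEv \<phi> = TUntil TTop \<phi>"

primrec tptl_sat :: "'a tword \<Rightarrow> nat \<Rightarrow> (var \<Rightarrow> real) \<Rightarrow> 'a tptl \<Rightarrow> bool" where
  "tptl_sat \<rho> i \<nu> (TAtom a) \<longleftrightarrow> letter \<rho> i = a"
| "tptl_sat \<rho> i \<nu> (TNAtom a) \<longleftrightarrow> letter \<rho> i \<noteq> a"
| "tptl_sat \<rho> i \<nu> TTop \<longleftrightarrow> True"
| "tptl_sat \<rho> i \<nu> TBot \<longleftrightarrow> False"
| "tptl_sat \<rho> i \<nu> (Freeze x \<phi>) \<longleftrightarrow> tptl_sat \<rho> i (\<nu>(x := stamp \<rho> i)) \<phi>"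
| "tptl_sat \<rho> i \<nu> (Constr x I) \<longleftrightarrow> stamp \<rho> i - \<nu> x \<in> I"
| "tptl_sat \<rho> i \<nu> (TAnd \<phi>1 \<phi>2) \<longleftrightarrow> tptl_sat \<rho> i \<nu> \<phi>1 \<and> tptl_sat \<rho> i \<nu> \<phi>2"
| "tptl_sat \<rho> i \<nu> (TOr \<phi>1 \<phi>2) \<longleftrightarrow> tptl_sat \<rho> i \<nu> \<phi>1 \<or> tptl_sat \<rho> i \<nu> \<phi>2"
| "tptl_sat \<rho> i \<nu> (TUntil \<phi>1 \<phi>2) \<longleftrightarrow>
     (\<exists>j\<in>positions \<rho>. i < j \<and> tptl_sat \<rho> j \<nu> \<phi>2 \<and>
        (\<forall>k. i < k \<and> k < j \<longrightarrow> tptl_sat \<rho> k \<nu> \<phi>1))"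
| "tptl_sat \<rho> i \<nu> (TGlob \<phi>) \<longleftrightarrow> (\<forall>j\<in>positions \<rho>. i < j \<longrightarrow> tptl_sat \<rho> j \<nu> \<phi>)"

text \<open>The initial valuation is irrelevant for closed formulae, the only ones whose language is
  considered.\<close>

definition tptl_lang :: "'a tptl \<Rightarrow> 'a tword set" where
  "tptl_lang \<phi> = {\<rho>. timed_word \<rho> \<and> tptl_sat \<rho> 0 (\<lambda>_. 0) \<phi>}"

primrec open_constrs :: "'a tptl \<Rightarrow> (var \<times> real set) set" where
  "open_constrs (TAtom a) = {}"
| "open_constrs (TNAtom a) = {}"
| "open_constrs TTop = {}"
| "open_constrs TBot = {}"
| "open_constrs (Freeze x \<phi>) = {(y, I) \<in> open_constrs \<phi>. y \<noteq> x}"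
| "open_constrs (Constr x I) = {(x, I)}"
| "open_constrs (TAnd \<phi>1 \<phi>2) = open_constrs \<phi>1 \<union> open_constrs \<phi>2"
| "open_constrs (TOr \<phi>1 \<phi>2) = open_constrs \<phi>1 \<union> open_constrs \<phi>2"
| "open_constrs (TUntil \<phi>1 \<phi>2) = open_constrs \<phi>1 \<union> open_constrs \<phi>2"
| "open_constrs (TGlob \<phi>) = open_constrs \<phi>"

definition tptl_closed :: "'a tptl \<Rightarrow> bool" where
  "tptl_closed \<phi> \<longleftrightarrow> open_constrs \<phi> = {}"

primrec subformulae :: "'a tptl \<Rightarrow> 'a tptl set" where
  "subformulae (TAtom a) = {TAtom a}"
| "subformulae (TNAtom a) = {TNAtom a}"
| "subformulae TTop = {TTop}"
| "subformulae TBot = {TBot}"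
| "subformulae (Freeze x \<phi>) = insert (Freeze x \<phi>) (subformulae \<phi>)"
| "subformulae (Constr x I) = {Constr x I}"
| "subformulae (TAnd \<phi>1 \<phi>2) = insert (TAnd \<phi>1 \<phi>2) (subformulae \<phi>1 \<union> subformulae \<phi>2)"
| "subformulae (TOr \<phi>1 \<phi>2) = insert (TOr \<phi>1 \<phi>2) (subformulae \<phi>1 \<union> subformulae \<phi>2)"
| "subformulae (TUntil \<phi>1 \<phi>2) = insert (TUntil \<phi>1 \<phi>2) (subformulae \<phi>1 \<union> subformulae \<phi>2)"
| "subformulae (TGlob \<phi>) = insert (TGlob \<phi>) (subformulae \<phi>)"

primrec tptl_vars :: "'a tptl \<Rightarrow> var set" where
  "tptl_vars (TAtom a) = {}"
| "tptl_vars (TNAtom a) = {}"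
| "tptl_vars TTop = {}"
| "tptl_vars TBot = {}"
| "tptl_vars (Freeze x \<phi>) = insert x (tptl_vars \<phi>)"
| "tptl_vars (Constr x I) = {x}"
| "tptl_vars (TAnd \<phi>1 \<phi>2) = tptl_vars \<phi>1 \<union> tptl_vars \<phi>2"
| "tptl_vars (TOr \<phi>1 \<phi>2) = tptl_vars \<phi>1 \<union> tptl_vars \<phi>2"
| "tptl_vars (TUntil \<phi>1 \<phi>2) = tptl_vars \<phi>1 \<union> tptl_vars \<phi>2"
| "tptl_vars (TGlob \<phi>) = tptl_vars \<phi>"

definition type_le :: "'a tptl \<Rightarrow> bool" where
  "type_le \<phi> \<longleftrightarrow> (\<forall>(x, I)\<in>open_constrs \<phi>. right_sided I)"

definition type_ge :: "'a tptl \<Rightarrow> bool" where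
  "type_ge \<phi> \<longleftrightarrow> (\<forall>(x, I)\<in>open_constrs \<phi>. left_sided I)"

text \<open>Every constraint occurring in a formula is itself a subformula in which its variable is
  open, so all its intervals have integer endpoints.\<close>

definition tptl_0_inf :: "'a tptl \<Rightarrow> bool" where
  "tptl_0_inf \<phi> \<longleftrightarrow> (\<forall>\<chi>\<in>subformulae \<phi>. type_le \<chi> \<or> type_ge \<chi>)"

definition one_tptl_0_inf :: "'a tptl \<Rightarrow> bool" where
  "one_tptl_0_inf \<phi> \<longleftrightarrow> tptl_0_inf \<phi> \<and> (\<exists>x. tptl_vars \<phi> \<subseteq> {x})"

end

theory Submission
  imports Defs
begin

text \<open>For a bounded interval \<open>I = \<langle>l,u\<rangle>\<close>, the formula \<open>\<psi>1 U\<^sub>I \<psi>2\<close> is equivalent to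
  \<open>\<psi>1 U\<^sub>J \<psi>2 \<and> F\<^sub>I \<psi>2\<close> with \<open>J = \<langle>l,\<infinity>)\<close>, since the first occurrence of \<open>\<psi>2\<close> in \<open>J\<close> lies in \<open>I\<close>.
  If \<open>F\<^sub>I \<psi>2\<close> fails although \<open>\<psi>2\<close> occurs in \<open>J\<close>, then \<open>I\<close> is covered by a gap of length at least 1
  between consecutive occurrences of \<open>\<psi>2\<close>. At most \<open>l + 1\<close> such gaps start before \<open>I\<close>, so one can
  guess the number \<open>k\<close> of the gap and state separately that the \<open>k\<close>th gap starts before \<open>I\<close>
  (right-sided constraints only) and that it ends after \<open>I\<close> (left-sided constraints only).

  Conversely, on the words with time stamps \<open>0, d, 2d, \<dots>\<close> and a single letter, with \<open>0 < d < 1\<close>, no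
  MITL formula depends on the position or on \<open>d\<close>, because every non-punctual non-empty interval with
  integer endpoints contains a positive multiple of \<open>d\<close>. The TPTL formula of the example holds
  exactly for \<open>d \<le> 1/2\<close>.\<close>

section \<open>Words, positions and the next occurrence of a property\<close>

lemma positions_downward:
  assumes "j \<in> positions \<rho>" "i \<le> j"
  shows "i \<in> positions \<rho>"
  using assms by (cases \<rho>) auto

lemma stamp_mono:
  assumes "timed_word \<rho>" "j \<in> positions \<rho>" "i \<le> j"
  shows "stamp \<rho> i \<le> stamp \<rho> j"
  using assms positions_downward[OF assms(2,3)] by (auto simp: timed_word_def)

definition until :: "'a tword \<Rightarrow> (nat \<Rightarrow> bool) \<Rightarrow> (nat \<Rightarrow> bool) \<Rightarrow> nat \<Rightarrow> bool" where
  "until \<rho> P Q i \<longleftrightarrow> (\<exists>j\<in>positions \<rho>. i < j \<and> Q j \<and> (\<forall>k. i < k \<and> k < j \<longrightarrow> P k))"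

definition next_at :: "'a tword \<Rightarrow> (nat \<Rightarrow> bool) \<Rightarrow> (nat \<Rightarrow> bool) \<Rightarrow> nat \<Rightarrow> bool" where
  "next_at \<rho> s Q = until \<rho> (\<lambda>k. \<not> s k) (\<lambda>j. s j \<and> Q j)"

lemma next_at_iff:
  "next_at \<rho> s Q i \<longleftrightarrow>
     (\<exists>j\<in>positions \<rho>. i < j \<and> s j \<and> Q j \<and> (\<forall>k. i < k \<and> k < j \<longrightarrow> \<not> s k))"
  by (auto simp: next_at_def until_def)

lemma next_atE:
  assumes "next_at \<rho> s Q i"
  obtains j where "j \<in> positions \<rho>" "i < j" "s j" "Q j" "\<And>k. i < k \<Longrightarrow> k < j \<Longrightarrow> \<not> s k"
  using assms by (auto simp: next_at_iff)

lemma next_exists: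
  assumes "m \<in> positions \<rho>" "i < m" "s m"
  obtains j where "j \<in> positions \<rho>" "i < j" "j \<le> m" "s j" "\<And>k. i < k \<Longrightarrow> k < j \<Longrightarrow> \<not> s k"
proof -
  define j where "j = (LEAST k. i < k \<and> s k)"
  have "i < j \<and> s j"
    unfolding j_def by (rule LeastI[of "\<lambda>k. i < k \<and> s k" m]) (use assms in simp)
  moreover have "j \<le> m"
    unfolding j_def by (rule Least_le) (use assms in simp)
  moreover have "\<not> s k" if "i < k" "k < j" for k
    using not_less_Least[of k "\<lambda>k. i < k \<and> s k"] that by (auto simp: j_def)
  ultimately show ?thesis
    using that positions_downward[OF assms(1)] by blast
qed

lemma next_at_conj:
  "next_at \<rho> s P i \<and> next_at \<rho> s Q i \<longleftrightarrow> next_at \<rho> s (\<lambda>j. P j \<and> Q j) i"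
proof
  assume *: "next_at \<rho> s P i \<and> next_at \<rho> s Q i"
  then obtain j where j: "j \<in> positions \<rho>" "i < j" "s j" "P j" "\<And>k. i < k \<Longrightarrow> k < j \<Longrightarrow> \<not> s k"
    by (auto elim: next_atE)
  from * obtain j' where j': "i < j'" "s j'" "Q j'" "\<And>k. i < k \<Longrightarrow> k < j' \<Longrightarrow> \<not> s k"
    by (auto elim: next_atE)
  have "j = j'"
    using j j' by (meson linorder_neqE_nat)
  then show "next_at \<rho> s (\<lambda>j. P j \<and> Q j) i"
    using j j' by (auto simp: next_at_iff)
qed (auto simp: next_at_iff)

text \<open>The iterate speaks of the \<open>k\<close>th \<open>s\<close>-position after
  \<open>i\<close>, which is unique if it exists. Two properties of it stated separately therefore
  hold together, which later lets constraints of opposite sides concern the same gap.\<close>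

lemma next_at_funpow_conj:
  "(next_at \<rho> s ^^ k) P i \<and> (next_at \<rho> s ^^ k) Q i \<longleftrightarrow> (next_at \<rho> s ^^ k) (\<lambda>j. P j \<and> Q j) i"
proof (induction k arbitrary: i)
  case (Suc k)
  have "(next_at \<rho> s ^^ Suc k) P i \<and> (next_at \<rho> s ^^ Suc k) Q i \<longleftrightarrow>
        next_at \<rho> s (\<lambda>j. (next_at \<rho> s ^^ k) P j \<and> (next_at \<rho> s ^^ k) Q j) i"
    using next_at_conj[of \<rho> s "(next_at \<rho> s ^^ k) P" i "(next_at \<rho> s ^^ k) Q"] by simp
  then show ?case
    by (simp add: Suc)
qed simp

lemma next_at_funpow_imp_ex:
  assumes "(next_at \<rho> s ^^ k) Q i"
  shows "\<exists>m\<ge>i. Q m"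
  using assms
proof (induction k arbitrary: i)
  case (Suc k)
  then obtain j where "i < j" "(next_at \<rho> s ^^ k) Q j"
    by (auto elim: next_atE)
  with Suc.IH[of j] show ?case
    by (meson le_trans less_imp_le)
qed auto

text \<open>By \<open>gap\<close>, each step from one \<open>s\<close>-position to the next takes at
  least one time unit, so the number of steps from \<open>i\<close> to \<open>m\<close> is at most
  the elapsed time.\<close>

lemma next_at_funpow_exists:
  assumes gap: "\<And>i. s i \<Longrightarrow> next_at \<rho> s (\<lambda>j. stamp \<rho> i + 1 \<le> stamp \<rho> j) i \<or> \<not> next_at \<rho> s (\<lambda>_. True) i"
    and "m \<in> positions \<rho>" "s m" "Q m" "s i" "i \<le> m"
  shows "\<exists>k. (next_at \<rho> s ^^ k) Q i \<and> real k \<le> stamp \<rho> m - stamp \<rho> i"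
  using \<open>s i\<close> \<open>i \<le> m\<close>
proof (induction "m - i" arbitrary: i rule: less_induct)
  case less
  show ?case
  proof (cases "i = m")
    case True
    with \<open>Q m\<close> show ?thesis
      by (intro exI[of _ 0]) simp
  next
    case False
    with less.prems have "i < m" by simp
    then obtain j where j: "j \<in> positions \<rho>" "i < j" "j \<le> m" "s j" "\<And>k. i < k \<Longrightarrow> k < j \<Longrightarrow> \<not> s k"
      using next_exists[of m \<rho> i s] \<open>m \<in> positions \<rho>\<close> \<open>s m\<close> by blast
    have "next_at \<rho> s (\<lambda>_. True) i"
      using j by (auto simp: next_at_iff)
    then obtain j' where j': "i < j'" "s j'" "stamp \<rho> i + 1 \<le> stamp \<rho> j'"
        "\<And>k. i < k \<Longrightarrow> k < j' \<Longrightarrow> \<not> s k"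
      using gap[OF \<open>s i\<close>] by (auto elim: next_atE)
    have "j = j'"
      using j j' by (meson linorder_neqE_nat)
    moreover obtain k where "(next_at \<rho> s ^^ k) Q j" "real k \<le> stamp \<rho> m - stamp \<rho> j"
      using less.hyps[OF _ j(4,3)] j(2,3) by (meson diff_less_mono2 less_le_trans)
    ultimately show ?thesis
      using j j' by (intro exI[of _ "Suc k"]) (auto simp: next_at_iff)
  qed
qed

section \<open>Gaps of length at least one between occurrences\<close>

definition gap_start :: "'a tword \<Rightarrow> (nat \<Rightarrow> bool) \<Rightarrow> nat \<Rightarrow> bool" where
  "gap_start \<rho> \<beta> m \<longleftrightarrow> \<beta> m \<and> next_at \<rho> \<beta> (\<lambda>j. 1 \<le> stamp \<rho> j - stamp \<rho> m) m"

text \<open>A gap start satisfies \<open>\<beta>\<close>, so the next one cannot come before the gap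
  starting at \<open>i\<close> has ended.\<close>

lemma gap_start_next:
  assumes "timed_word \<rho>" "gap_start \<rho> \<beta> i" "next_at \<rho> (gap_start \<rho> \<beta>) (\<lambda>_. True) i"
  shows "next_at \<rho> (gap_start \<rho> \<beta>) (\<lambda>j. stamp \<rho> i + 1 \<le> stamp \<rho> j) i"
proof -
  obtain n where n: "n \<in> positions \<rho>" "i < n" "gap_start \<rho> \<beta> n"
      "\<And>k. i < k \<Longrightarrow> k < n \<Longrightarrow> \<not> gap_start \<rho> \<beta> k"
    using assms(3) by (auto elim: next_atE)
  obtain j where j: "i < j" "1 \<le> stamp \<rho> j - stamp \<rho> i" "\<And>k. i < k \<Longrightarrow> k < j \<Longrightarrow> \<not> \<beta> k"
    using assms(2) by (auto simp: gap_start_def elim: next_atE)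
  have "j \<le> n"
    using n j by (meson gap_start_def not_le)
  then have "stamp \<rho> j \<le> stamp \<rho> n"
    using stamp_mono[OF assms(1) n(1)] by simp
  then show ?thesis
    using n j by (auto simp: next_at_iff)
qed

text \<open>The second disjunct covers the gap that starts at \<open>i\<close> itself, where \<open>\<beta>\<close> need not hold. The gap
  starts after \<open>i\<close> are numbered from 0.\<close>

lemma no_occurrence_iff:
  fixes l u :: nat
  assumes \<rho>: "timed_word \<rho>"
    and J: "J \<in> {{real l..}, {real l<..}}" and K: "K \<in> {{..real u}, {..<real u}}" and "l < u"
  shows "\<not> (\<exists>j\<in>positions \<rho>. i < j \<and> \<beta> j \<and> stamp \<rho> j - stamp \<rho> i \<in> J \<inter> K) \<longleftrightarrow>
    \<not> (\<exists>j\<in>positions \<rho>. i < j \<and> \<beta> j \<and> stamp \<rho> j - stamp \<rho> i \<in> J) \<or>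
    next_at \<rho> \<beta> (\<lambda>j. stamp \<rho> j - stamp \<rho> i \<notin> K) i \<or>
    (\<exists>k\<le>l. (next_at \<rho> (gap_start \<rho> \<beta>) ^^ Suc k) (\<lambda>m. stamp \<rho> m - stamp \<rho> i \<notin> J) i \<and>
           (next_at \<rho> (gap_start \<rho> \<beta>) ^^ Suc k)
             (next_at \<rho> \<beta> (\<lambda>j. stamp \<rho> j - stamp \<rho> i \<notin> K)) i)"
    (is "?lhs \<longleftrightarrow> ?none \<or> ?first \<or> (\<exists>k\<le>l. ?left k \<and> ?right k)")
proof -
  define s where "s = gap_start \<rho> \<beta>"
  define L where "L m \<longleftrightarrow> stamp \<rho> m - stamp \<rho> i \<notin> J" for m
  define R where "R = next_at \<rho> \<beta> (\<lambda>j. stamp \<rho> j - stamp \<rho> i \<notin> K)"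
  have J_up: "y \<in> J" if "x \<in> J" "x \<le> y" for x y using J that by auto
  have K_down: "x \<in> K" if "y \<in> K" "x \<le> y" for x y using K that by auto
  \<comment> \<open>\<open>R m\<close> constrains only the first occurrence after \<open>m\<close>;
    as stamps are monotone and \<open>K\<close> is downward closed, all later ones miss
    \<open>K\<close> too.\<close>
  have later: "stamp \<rho> j - stamp \<rho> i \<notin> K"
    if "R m" "j \<in> positions \<rho>" "m < j" "\<beta> j" for m j
  proof -
    obtain n where n: "m < n" "stamp \<rho> n - stamp \<rho> i \<notin> K" "\<And>k. m < k \<Longrightarrow> k < n \<Longrightarrow> \<not> \<beta> k"
      using \<open>R m\<close> by (auto simp: R_def elim: next_atE)
    have "n \<le> j" using n that by (meson not_le)
    then have "stamp \<rho> n \<le> stamp \<rho> j" using stamp_mono[OF \<rho>] that by blast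
    then show ?thesis using K_down[of "stamp \<rho> j - stamp \<rho> i" "stamp \<rho> n - stamp \<rho> i"] n(2) by auto
  qed
  have "?lhs" if "?none" using that by blast
  moreover have "?lhs" if "?first"
    using later[of i, unfolded R_def, OF that] by blast
  moreover have "?lhs" if "?left k" "?right k" for k
  proof -
    \<comment> \<open>Both iterates reach the same position \<open>m\<close>: occurrences up to
      \<open>m\<close> come too early for \<open>J\<close>, those after \<open>m\<close> too late
      for \<open>K\<close>.\<close>
    have "(next_at \<rho> s ^^ Suc k) (\<lambda>m. L m \<and> R m) i"
      using that by (simp only: next_at_funpow_conj[symmetric] L_def R_def s_def)
    then obtain j where j: "i < j" "(next_at \<rho> s ^^ k) (\<lambda>m. L m \<and> R m) j"
      by (auto elim: next_atE)
    then obtain m where m: "j \<le> m" "L m" "R m"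
      using next_at_funpow_imp_ex by blast
    have mpos: "m \<in> positions \<rho>"
      using \<open>R m\<close> positions_downward by (auto simp: R_def elim!: next_atE intro: less_imp_le)
    show ?lhs
    proof clarify
      fix n assume n: "n \<in> positions \<rho>" "i < n" "\<beta> n"
        and "stamp \<rho> n - stamp \<rho> i \<in> J" "stamp \<rho> n - stamp \<rho> i \<in> K"
      then have "n \<le> m" using later \<open>R m\<close> not_le by blast
      then have "stamp \<rho> n \<le> stamp \<rho> m" using stamp_mono[OF \<rho> mpos] by blast
      then show False
        using \<open>L m\<close> \<open>stamp \<rho> n - stamp \<rho> i \<in> J\<close>
          J_up[of "stamp \<rho> n - stamp \<rho> i" "stamp \<rho> m - stamp \<rho> i"] by (simp add: L_def)
    qed
  qed
  moreover have "?none \<or> ?first \<or> (\<exists>k\<le>l. ?left k \<and> ?right k)" if lhs: ?lhs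
  proof (cases ?none)
    case False
    then obtain p where p: "p \<in> positions \<rho>" "i < p" "\<beta> p" "stamp \<rho> p - stamp \<rho> i \<in> J"
      by blast
    \<comment> \<open>The occurrences after \<open>i\<close> that come before \<open>J\<close>. The
      witness \<open>p\<close> in \<open>J\<close> keeps this set finite, and its last element will
      start the gap that covers the interval.\<close>
    define B where "B = {m. i < m \<and> m \<le> p \<and> \<beta> m \<and> L m}"
    have fin: "finite B" by (rule finite_subset[of _ "{..p}"]) (auto simp: B_def)
    \<comment> \<open>The next occurrence after such an \<open>m\<close> lies at or before
      \<open>p\<close> and outside \<open>B\<close>, hence in \<open>J\<close>, and so by
      \<open>lhs\<close> outside \<open>K\<close>.\<close>
    have R_if: "R m" if "i \<le> m" "m < p" "\<And>n. n \<in> B \<Longrightarrow> n \<le> m" for m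
    proof -
      obtain j where j: "j \<in> positions \<rho>" "m < j" "j \<le> p" "\<beta> j" "\<And>k. m < k \<Longrightarrow> k < j \<Longrightarrow> \<not> \<beta> k"
        using next_exists[of p \<rho> m \<beta>] p \<open>m < p\<close> by blast
      have "j \<notin> B" using that(3)[of j] j(2) by auto
      then have "stamp \<rho> j - stamp \<rho> i \<in> J"
        using j(2-4) that(1) by (simp add: B_def L_def)
      then have "stamp \<rho> j - stamp \<rho> i \<notin> K"
        using lhs j(1,2,4) that(1) le_less_trans by blast
      then show ?thesis unfolding R_def next_at_iff using j by blast
    qed
    show ?thesis
    proof (cases "B = {}")
      case True
      then show ?thesis using R_if[of i] p by (auto simp: R_def)
    next
      case False
      define m where "m = Max B"
      have "m \<in> B" and max: "\<And>n. n \<in> B \<Longrightarrow> n \<le> m"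
        using fin False by (auto simp: m_def)
      then have m: "i < m" "m \<le> p" "\<beta> m" "L m" by (auto simp: B_def)
      have "m \<noteq> p" using m p by (auto simp: L_def)
      then have "m < p" "m \<in> positions \<rho>" using m p positions_downward by auto
      then have "R m" using R_if[of m] m max by auto
      have bound: "stamp \<rho> m - stamp \<rho> i \<le> real l" using \<open>L m\<close> J by (auto simp: L_def)
      have "s m"
      proof -
        \<comment> \<open>The gap reaches from at most \<open>l\<close> to at least
          \<open>u\<close>, and \<open>l < u\<close> for natural numbers gives length at least
          1.\<close>
        have "1 \<le> stamp \<rho> j - stamp \<rho> m" if "stamp \<rho> j - stamp \<rho> i \<notin> K" for j
        proof -
          have "real u \<le> stamp \<rho> j - stamp \<rho> i" using K that by auto
          moreover have "real l + 1 \<le> real u" using \<open>l < u\<close> by linarith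
          ultimately show ?thesis using bound by linarith
        qed
        then show ?thesis using \<open>R m\<close> \<open>\<beta> m\<close> by (auto simp: s_def R_def gap_start_def next_at_iff)
      qed
      obtain n where n: "n \<in> positions \<rho>" "i < n" "n \<le> m" "s n" "\<And>k. i < k \<Longrightarrow> k < n \<Longrightarrow> \<not> s k"
        using next_exists[of m \<rho> i s] \<open>m \<in> positions \<rho>\<close> \<open>i < m\<close> \<open>s m\<close> by blast
      \<comment> \<open>Counting starts at \<open>n\<close>, the first gap start after
        \<open>i\<close>; the step from \<open>i\<close> to \<open>n\<close> is the extra one in
        \<open>Suc k\<close>.\<close>
      have "\<exists>k. (next_at \<rho> s ^^ k) (\<lambda>m. L m \<and> R m) n \<and> real k \<le> stamp \<rho> m - stamp \<rho> n"
        using gap_start_next[OF \<rho>, of \<beta>] \<open>m \<in> positions \<rho>\<close> \<open>s m\<close> \<open>L m\<close> \<open>R m\<close> n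
        by (intro next_at_funpow_exists) (auto simp: s_def)
      then obtain k where k: "(next_at \<rho> s ^^ k) (\<lambda>m. L m \<and> R m) n" "real k \<le> stamp \<rho> m - stamp \<rho> n"
        by blast
      have "stamp \<rho> i \<le> stamp \<rho> n" using stamp_mono[OF \<rho>] n by simp
      then have "k \<le> l" using k bound by linarith
      moreover have "(next_at \<rho> s ^^ Suc k) (\<lambda>m. L m \<and> R m) i"
        using k n by (auto simp: next_at_iff)
      ultimately show ?thesis
        by (simp only: next_at_funpow_conj[symmetric] L_def R_def s_def) blast
    qed
  qed simp
  ultimately show ?thesis by blast
qed

section \<open>Definable properties\<close>

text \<open>\<open>S\<close> restricts the intervals of the open constraints, which all concern the variable 0;
  \<open>\<lambda>_. False\<close> describes the closed formulae. The value of the variable is passed to the defined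
  property as its last argument.\<close>

definition expresses ::
  "(real set \<Rightarrow> bool) \<Rightarrow> 'a tptl \<Rightarrow> ('a tword \<Rightarrow> nat \<Rightarrow> real \<Rightarrow> bool) \<Rightarrow> bool" where
  "expresses S \<phi> P \<longleftrightarrow> tptl_vars \<phi> \<subseteq> {0} \<and> (\<forall>(x, I)\<in>open_constrs \<phi>. S I) \<and> tptl_0_inf \<phi> \<and>
     (\<forall>\<rho> i \<nu>. timed_word \<rho> \<longrightarrow> i \<in> positions \<rho> \<longrightarrow> \<nu> 0 \<le> stamp \<rho> i \<longrightarrow>
        (tptl_sat \<rho> i \<nu> \<phi> \<longleftrightarrow> P \<rho> i (\<nu> 0)))"

definition definable ::
  "(real set \<Rightarrow> bool) \<Rightarrow> ('a tword \<Rightarrow> nat \<Rightarrow> real \<Rightarrow> bool) \<Rightarrow> bool" where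
  "definable S P \<longleftrightarrow> (\<exists>\<phi>. expresses S \<phi> P)"

definition one_sided :: "(real set \<Rightarrow> bool) \<Rightarrow> bool" where
  "one_sided S \<longleftrightarrow> S \<le> right_sided \<or> S \<le> left_sided"

lemma one_sided_simps [simp]:
  "one_sided right_sided" "one_sided left_sided" "one_sided (\<lambda>_. False)"
  by (auto simp: one_sided_def)

lemma type_if_one_sided:
  assumes "one_sided S" "\<forall>(x, I)\<in>open_constrs \<phi>. S I"
  shows "type_le \<phi> \<or> type_ge \<phi>"
  using assms by (auto simp: one_sided_def type_le_def type_ge_def le_fun_def)

lemma expressesI:
  assumes "one_sided S" "tptl_vars \<phi> \<subseteq> {0}" "\<forall>(x, I)\<in>open_constrs \<phi>. S I"
    and "\<forall>\<chi>\<in>subformulae \<phi>. \<chi> = \<phi> \<or> type_le \<chi> \<or> type_ge \<chi>"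
    and "\<And>\<rho> i \<nu>. timed_word \<rho> \<Longrightarrow> i \<in> positions \<rho> \<Longrightarrow> \<nu> 0 \<le> stamp \<rho> i \<Longrightarrow>
        tptl_sat \<rho> i \<nu> \<phi> \<longleftrightarrow> P \<rho> i (\<nu> 0)"
  shows "expresses S \<phi> P"
  unfolding expresses_def tptl_0_inf_def
  using assms(2-5) type_if_one_sided[OF assms(1,3)] by (intro conjI) auto

lemma expresses_vars: "expresses S \<phi> P \<Longrightarrow> tptl_vars \<phi> \<subseteq> {0}"
  and expresses_open_constrs: "expresses S \<phi> P \<Longrightarrow> \<forall>(x, I)\<in>open_constrs \<phi>. S I"
  and expresses_subformulae: "expresses S \<phi> P \<Longrightarrow> \<forall>\<chi>\<in>subformulae \<phi>. type_le \<chi> \<or> type_ge \<chi>"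
  and expresses_sat: "expresses S \<phi> P \<Longrightarrow> timed_word \<rho> \<Longrightarrow> i \<in> positions \<rho> \<Longrightarrow> \<nu> 0 \<le> stamp \<rho> i \<Longrightarrow>
        tptl_sat \<rho> i \<nu> \<phi> \<longleftrightarrow> P \<rho> i (\<nu> 0)"
  by (simp_all add: expresses_def tptl_0_inf_def)

lemma definable_cong:
  assumes "definable S P"
    and "\<And>\<rho> i t. timed_word \<rho> \<Longrightarrow> i \<in> positions \<rho> \<Longrightarrow> t \<le> stamp \<rho> i \<Longrightarrow> P \<rho> i t \<longleftrightarrow> Q \<rho> i t"
  shows "definable S Q"
proof -
  obtain \<phi> where "expresses S \<phi> P"
    using assms(1) by (auto simp: definable_def)
  then have "expresses S \<phi> Q"
    using assms(2) by (simp add: expresses_def)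
  then show ?thesis by (auto simp: definable_def)
qed

lemma definable_mono:
  assumes "definable (\<lambda>_. False) P"
  shows "definable S P"
proof -
  obtain \<phi> where "expresses (\<lambda>_. False) \<phi> P"
    using assms by (auto simp: definable_def)
  then have "expresses S \<phi> P"
    by (auto simp: expresses_def)
  then show ?thesis by (auto simp: definable_def)
qed

section \<open>Closure of definability under the connectives\<close>

lemma definable_atom:
  assumes "one_sided S"
  shows "definable S (\<lambda>\<rho> i t. letter \<rho> i = a)" "definable S (\<lambda>\<rho> i t. letter \<rho> i \<noteq> a)"
  unfolding definable_def
  by (rule exI[of _ "TAtom a"], rule expressesI; use assms in simp)
     (rule exI[of _ "TNAtom a"], rule expressesI; use assms in simp)

lemma definable_const:
  assumes "one_sided S"
  shows "definable S (\<lambda>\<rho> i t. c)"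
  unfolding definable_def
  by (rule exI[of _ "if c then TTop else TBot"], rule expressesI; use assms in \<open>simp split: if_splits\<close>)

lemma definable_constr:
  assumes "one_sided S" "S I"
  shows "definable S (\<lambda>\<rho> i t. stamp \<rho> i - t \<in> I)"
  unfolding definable_def by (rule exI[of _ "Constr 0 I"], rule expressesI; use assms in simp)

lemma definable_conj:
  assumes "one_sided S" "definable S P" "definable S Q"
  shows "definable S (\<lambda>\<rho> i t. P \<rho> i t \<and> Q \<rho> i t)"
proof -
  obtain \<phi> \<psi> where defs: "expresses S \<phi> P" "expresses S \<psi> Q"
    using assms(2,3) by (auto simp: definable_def)
  have "expresses S (TAnd \<phi> \<psi>) (\<lambda>\<rho> i t. P \<rho> i t \<and> Q \<rho> i t)"
    using defs[THEN expresses_vars] defs[THEN expresses_open_constrs] defs[THEN expresses_subformulae]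
    by (intro expressesI[OF assms(1)]) (auto simp: defs[THEN expresses_sat])
  then show ?thesis by (auto simp: definable_def)
qed

lemma definable_disj:
  assumes "one_sided S" "definable S P" "definable S Q"
  shows "definable S (\<lambda>\<rho> i t. P \<rho> i t \<or> Q \<rho> i t)"
proof -
  obtain \<phi> \<psi> where defs: "expresses S \<phi> P" "expresses S \<psi> Q"
    using assms(2,3) by (auto simp: definable_def)
  have "expresses S (TOr \<phi> \<psi>) (\<lambda>\<rho> i t. P \<rho> i t \<or> Q \<rho> i t)"
    using defs[THEN expresses_vars] defs[THEN expresses_open_constrs] defs[THEN expresses_subformulae]
    by (intro expressesI[OF assms(1)]) (auto simp: defs[THEN expresses_sat])
  then show ?thesis by (auto simp: definable_def)
qed

text \<open>The quantifier over \<open>k\<close> in \<open>until\<close> is not limited to positions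
  of the word, but every \<open>k\<close> below a witness is one because positions are downward
  closed.\<close>

lemma until_cong:
  assumes "\<And>j. j \<in> positions \<rho> \<Longrightarrow> i < j \<Longrightarrow> P j \<longleftrightarrow> P' j"
    and "\<And>j. j \<in> positions \<rho> \<Longrightarrow> i < j \<Longrightarrow> Q j \<longleftrightarrow> Q' j"
  shows "until \<rho> P Q i \<longleftrightarrow> until \<rho> P' Q' i"
proof -
  have "(\<forall>k. i < k \<and> k < j \<longrightarrow> P k) \<longleftrightarrow> (\<forall>k. i < k \<and> k < j \<longrightarrow> P' k)" if "j \<in> positions \<rho>" for j
    using assms(1) positions_downward[OF that] by (meson less_imp_le)
  then show ?thesis
    unfolding until_def using assms(2) by (intro bex_cong) auto
qed

lemma definable_until:
  assumes "one_sided S" "definable S P" "definable S Q"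
  shows "definable S (\<lambda>\<rho> i t. until \<rho> (\<lambda>j. P \<rho> j t) (\<lambda>j. Q \<rho> j t) i)"
proof -
  obtain \<phi> \<psi> where defs: "expresses S \<phi> P" "expresses S \<psi> Q"
    using assms(2,3) by (auto simp: definable_def)
  have "expresses S (TUntil \<phi> \<psi>) (\<lambda>\<rho> i t. until \<rho> (\<lambda>j. P \<rho> j t) (\<lambda>j. Q \<rho> j t) i)"
  proof (rule expressesI[OF assms(1)])
    fix \<rho> :: "'a tword" and i and \<nu> :: "nat \<Rightarrow> real"
    assume *: "timed_word \<rho>" "i \<in> positions \<rho>" "\<nu> 0 \<le> stamp \<rho> i"
    have le: "\<nu> 0 \<le> stamp \<rho> j" if "j \<in> positions \<rho>" "i < j" for j
      using stamp_mono[OF *(1) that(1), of i] that(2) *(3) by simp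
    have "tptl_sat \<rho> i \<nu> (TUntil \<phi> \<psi>) \<longleftrightarrow>
        until \<rho> (\<lambda>j. tptl_sat \<rho> j \<nu> \<phi>) (\<lambda>j. tptl_sat \<rho> j \<nu> \<psi>) i"
      by (simp add: until_def)
    also have "\<dots> \<longleftrightarrow> until \<rho> (\<lambda>j. P \<rho> j (\<nu> 0)) (\<lambda>j. Q \<rho> j (\<nu> 0)) i"
      by (rule until_cong) (simp_all add: defs[THEN expresses_sat] * le)
    finally show "tptl_sat \<rho> i \<nu> (TUntil \<phi> \<psi>) \<longleftrightarrow> \<dots>" .
  qed (use defs[THEN expresses_vars] defs[THEN expresses_open_constrs] defs[THEN expresses_subformulae]
      in auto)
  then show ?thesis by (auto simp: definable_def)
qed

lemma definable_globally:
  assumes "one_sided S" "definable S P"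
  shows "definable S (\<lambda>\<rho> i t. \<forall>j\<in>positions \<rho>. i < j \<longrightarrow> P \<rho> j t)"
proof -
  obtain \<phi> where def: "expresses S \<phi> P"
    using assms(2) by (auto simp: definable_def)
  have "expresses S (TGlob \<phi>) (\<lambda>\<rho> i t. \<forall>j\<in>positions \<rho>. i < j \<longrightarrow> P \<rho> j t)"
  proof (rule expressesI[OF assms(1)])
    fix \<rho> :: "'a tword" and i and \<nu> :: "nat \<Rightarrow> real"
    assume *: "timed_word \<rho>" "i \<in> positions \<rho>" "\<nu> 0 \<le> stamp \<rho> i"
    have "\<nu> 0 \<le> stamp \<rho> j" if "j \<in> positions \<rho>" "i < j" for j
      using stamp_mono[OF *(1) that(1), of i] that(2) *(3) by simp
    then show "tptl_sat \<rho> i \<nu> (TGlob \<phi>) \<longleftrightarrow> (\<forall>j\<in>positions \<rho>. i < j \<longrightarrow> P \<rho> j (\<nu> 0))"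
      by (simp add: expresses_sat[OF def] *)
  qed (use expresses_vars[OF def] expresses_open_constrs[OF def] expresses_subformulae[OF def] in auto)
  then show ?thesis by (auto simp: definable_def)
qed

lemma open_constrs_vars: "(x, I) \<in> open_constrs \<phi> \<Longrightarrow> x \<in> tptl_vars \<phi>"
  by (induction \<phi>) auto

text \<open>Freezing binds the only variable, so the side of the constraints in
  \<open>\<phi>\<close> is no longer visible from outside. Formulae of opposite sides can be
  combined once each is frozen.\<close>

lemma definable_freeze:
  assumes "definable S P"
  shows "definable (\<lambda>_. False) (\<lambda>\<rho> i t. P \<rho> i (stamp \<rho> i))"
proof -
  obtain \<phi> where def: "expresses S \<phi> P"
    using assms by (auto simp: definable_def)
  have "open_constrs (Freeze 0 \<phi>) = {}"
    using expresses_vars[OF def] open_constrs_vars by fastforce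
  then have "expresses (\<lambda>_. False) (Freeze 0 \<phi>) (\<lambda>\<rho> i t. P \<rho> i (stamp \<rho> i))"
    using expresses_vars[OF def] expresses_subformulae[OF def]
    by (intro expressesI) (auto simp: expresses_sat[OF def])
  then show ?thesis by (auto simp: definable_def)
qed

text \<open>Only atoms can be negated in the logic, so a property is tracked together with its complement: negating
  a right-sided constraint gives a left-sided one and vice versa.\<close>

definition bidefinable ::
  "(real set \<Rightarrow> bool) \<Rightarrow> (real set \<Rightarrow> bool) \<Rightarrow> ('a tword \<Rightarrow> nat \<Rightarrow> real \<Rightarrow> bool) \<Rightarrow> bool" where
  "bidefinable S T P \<longleftrightarrow>
     one_sided S \<and> one_sided T \<and> definable S P \<and> definable T (\<lambda>\<rho> i t. \<not> P \<rho> i t)"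

abbreviation closed_definable :: "('a tword \<Rightarrow> nat \<Rightarrow> bool) \<Rightarrow> bool" where
  "closed_definable P \<equiv> bidefinable (\<lambda>_. False) (\<lambda>_. False) (\<lambda>\<rho> i t. P \<rho> i)"

section \<open>Closure of properties given with their complements\<close>

lemma bidefinable_cong:
  assumes "bidefinable S T P"
    and "\<And>\<rho> i t. timed_word \<rho> \<Longrightarrow> i \<in> positions \<rho> \<Longrightarrow> t \<le> stamp \<rho> i \<Longrightarrow> P \<rho> i t \<longleftrightarrow> Q \<rho> i t"
  shows "bidefinable S T Q"
  using assms(1) definable_cong[of S P Q]
    definable_cong[of T "\<lambda>\<rho> i t. \<not> P \<rho> i t" "\<lambda>\<rho> i t. \<not> Q \<rho> i t"]
  unfolding bidefinable_def by (simp add: assms(2))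

lemma bidefinable_closed:
  assumes "closed_definable P" "one_sided S" "one_sided T"
  shows "bidefinable S T (\<lambda>\<rho> i t. P \<rho> i)"
  using assms definable_mono unfolding bidefinable_def by blast

lemma bidefinable_not:
  assumes "bidefinable S T P"
  shows "bidefinable T S (\<lambda>\<rho> i t. \<not> P \<rho> i t)"
  using assms by (simp add: bidefinable_def)

lemma bidefinable_conj:
  assumes "bidefinable S T P" "bidefinable S T Q"
  shows "bidefinable S T (\<lambda>\<rho> i t. P \<rho> i t \<and> Q \<rho> i t)"
  using assms definable_conj[of S P Q]
    definable_disj[of T "\<lambda>\<rho> i t. \<not> P \<rho> i t" "\<lambda>\<rho> i t. \<not> Q \<rho> i t"]
  unfolding bidefinable_def de_Morgan_conj by blast

lemma bidefinable_disj:
  assumes "bidefinable S T P" "bidefinable S T Q"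
  shows "bidefinable S T (\<lambda>\<rho> i t. P \<rho> i t \<or> Q \<rho> i t)"
  using bidefinable_not[OF bidefinable_conj[OF bidefinable_not[OF assms(1)]
        bidefinable_not[OF assms(2)]]] by simp

lemma bidefinable_const:
  assumes "one_sided S" "one_sided T"
  shows "bidefinable S T (\<lambda>\<rho> i t. c)"
  using assms by (simp add: bidefinable_def definable_const)

lemma bidefinable_ex_le:
  fixes n :: nat
  assumes "\<And>k. bidefinable S T (P k)"
  shows "bidefinable S T (\<lambda>\<rho> i t. \<exists>k\<le>n. P k \<rho> i t)"
proof (induction n)
  case (Suc n)
  show ?case
    by (rule bidefinable_cong[OF bidefinable_disj[OF Suc assms[of "Suc n"]]]) (auto simp: le_Suc_eq)
qed (simp add: assms)

text \<open>If \<open>until\<close> fails although \<open>Q\<close> occurs later, \<open>P\<close>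
  must fail strictly before the first \<open>Q\<close>. This reduces the negation to until and
  globally, the only temporal operators of the logic.\<close>

lemma not_until_iff:
  "\<not> until \<rho> P Q i \<longleftrightarrow>
     (\<forall>j\<in>positions \<rho>. i < j \<longrightarrow> \<not> Q j) \<or> until \<rho> (\<lambda>j. \<not> Q j) (\<lambda>j. \<not> P j \<and> \<not> Q j) i"
proof
  assume *: "\<not> until \<rho> P Q i"
  show "(\<forall>j\<in>positions \<rho>. i < j \<longrightarrow> \<not> Q j) \<or> until \<rho> (\<lambda>j. \<not> Q j) (\<lambda>j. \<not> P j \<and> \<not> Q j) i"
  proof (rule disjCI)
    assume "\<not> until \<rho> (\<lambda>j. \<not> Q j) (\<lambda>j. \<not> P j \<and> \<not> Q j) i"
    then have no: "\<exists>k. i < k \<and> k < j \<and> Q k"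
      if "j \<in> positions \<rho>" "i < j" "\<not> P j" "\<not> Q j" for j
      using that by (auto simp: until_def)
    show "\<forall>j\<in>positions \<rho>. i < j \<longrightarrow> \<not> Q j"
    proof (intro ballI impI notI)
      fix m assume "m \<in> positions \<rho>" "i < m" "Q m"
      \<comment> \<open>Before the first \<open>Q\<close>, at \<open>j\<close>, some
        \<open>k\<close> violates \<open>P\<close>; then \<open>no\<close> yields a \<open>Q\<close>
        even before \<open>k\<close>, against the choice of \<open>j\<close>.\<close>
      then obtain j where j: "j \<in> positions \<rho>" "i < j" "Q j" "\<And>k. i < k \<Longrightarrow> k < j \<Longrightarrow> \<not> Q k"
        using next_exists by metis
      then obtain k where k: "i < k" "k < j" "\<not> P k"
        using * by (auto simp: until_def)
      then have "k \<in> positions \<rho>" using j(1) positions_downward[of j \<rho> k] by auto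
      then show False using no[of k] k j by (meson less_trans)
    qed
  qed
next
  assume "(\<forall>j\<in>positions \<rho>. i < j \<longrightarrow> \<not> Q j) \<or> until \<rho> (\<lambda>j. \<not> Q j) (\<lambda>j. \<not> P j \<and> \<not> Q j) i"
  then show "\<not> until \<rho> P Q i"
    unfolding until_def by (metis linorder_neqE_nat)
qed

lemma bidefinable_until:
  assumes "bidefinable S T P" "bidefinable S T Q"
  shows "bidefinable S T (\<lambda>\<rho> i t. until \<rho> (\<lambda>j. P \<rho> j t) (\<lambda>j. Q \<rho> j t) i)"
  using assms unfolding bidefinable_def not_until_iff
  by (intro conjI definable_until definable_disj definable_globally definable_conj) auto

lemma bidefinable_next_at:
  assumes "bidefinable S T P" "closed_definable s"
  shows "bidefinable S T (\<lambda>\<rho> i t. next_at \<rho> (s \<rho>) (\<lambda>j. P \<rho> j t) i)"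
proof -
  have "one_sided S" "one_sided T" using assms(1) by (auto simp: bidefinable_def)
  then have s: "bidefinable S T (\<lambda>\<rho> i t. s \<rho> i)" "bidefinable S T (\<lambda>\<rho> i t. \<not> s \<rho> i)"
    using bidefinable_closed[OF assms(2)] bidefinable_closed[OF bidefinable_not[OF assms(2)]]
    by auto
  show ?thesis
    unfolding next_at_def by (rule bidefinable_until[OF s(2) bidefinable_conj[OF s(1) assms(1)]])
qed

lemma bidefinable_next_at_funpow:
  assumes "bidefinable S T P" "closed_definable s"
  shows "bidefinable S T (\<lambda>\<rho> i t. (next_at \<rho> (s \<rho>) ^^ k) (\<lambda>j. P \<rho> j t) i)"
  by (induction k) (auto simp: assms intro: bidefinable_next_at)

lemma bidefinable_freeze:
  assumes "bidefinable S T P"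
  shows "closed_definable (\<lambda>\<rho> i. P \<rho> i (stamp \<rho> i))"
  using assms definable_freeze[of S P] definable_freeze[of T "\<lambda>\<rho> i t. \<not> P \<rho> i t"]
  by (auto simp: bidefinable_def)

text \<open>The stored value never exceeds the current stamp, so the complement may be taken within
  the nonnegative reals, where it is right-sided.\<close>

lemma bidefinable_lower:
  assumes "J \<in> {{real l..}, {real l<..}}"
  shows "bidefinable left_sided right_sided (\<lambda>\<rho> i t. stamp \<rho> i - t \<in> J)"
proof -
  have "left_sided J" using assms by (auto simp: left_sided_def)
  moreover have "right_sided ({0..} - J)"
  proof -
    \<comment> \<open>For \<open>l = 0\<close> these are \<open>{0..0}\<close> and the empty
      interval \<open>{0..<0}\<close>.\<close>
    have "{0..} - J \<in> {{0..real l}, {0..<real l}}" using assms by auto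
    then show ?thesis unfolding right_sided_def by blast
  qed
  ultimately show ?thesis
    unfolding bidefinable_def
    by (auto intro!: definable_constr definable_cong[OF definable_constr[of right_sided "{0..} - J"]])
qed

lemma bidefinable_upper:
  assumes "K \<in> {{..real u}, {..<real u}}"
  shows "bidefinable left_sided right_sided (\<lambda>\<rho> i t. stamp \<rho> i - t \<notin> K)"
proof -
  have "- K \<in> {{real u..}, {real u<..}}" using assms by auto
  from bidefinable_lower[OF this] show ?thesis by simp
qed

section \<open>From MITL to one-variable TPTL with one-sided intervals\<close>

text \<open>The right-hand side of \<open>no_occurrence_iff\<close> combines properties that each
  use constraints of one side only. Each becomes closed by its own freeze at \<open>i\<close>, after
  which they can be mixed and negated.\<close>

lemma closed_definable_eventually:
  assumes \<beta>: "closed_definable \<beta>"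
    and J: "J \<in> {{real l..}, {real l<..}}" and K: "K \<in> {{..real u}, {..<real u}}" and "l < u"
  shows "closed_definable (\<lambda>\<rho> i. \<exists>j\<in>positions \<rho>. i < j \<and> \<beta> \<rho> j \<and> stamp \<rho> j - stamp \<rho> i \<in> J \<inter> K)"
proof -
  have one: "one_sided left_sided" "one_sided right_sided" by auto
  have lower: "bidefinable left_sided right_sided (\<lambda>\<rho> i t. stamp \<rho> i - t \<in> J)"
    using J by (rule bidefinable_lower)
  have upper: "bidefinable left_sided right_sided (\<lambda>\<rho> i t. stamp \<rho> i - t \<notin> K)"
    using K by (rule bidefinable_upper)
  \<comment> \<open>The threshold 1 is measured from the gap start itself, not from
    \<open>i\<close>, so the property is closed and can mark positions inside formulae of either
    side.\<close>
  have gap: "closed_definable (\<lambda>\<rho>. gap_start \<rho> (\<beta> \<rho>))"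
  proof -
    have "bidefinable left_sided right_sided (\<lambda>\<rho> i t. stamp \<rho> i - t \<in> {real 1..})"
      by (rule bidefinable_lower[of _ 1]) simp
    from bidefinable_conj[OF \<beta> bidefinable_freeze[OF bidefinable_next_at[OF this \<beta>]]]
    show ?thesis by (simp add: gap_start_def)
  qed
  have "closed_definable (\<lambda>\<rho> i. until \<rho> (\<lambda>_. True) (\<lambda>j. \<beta> \<rho> j \<and> stamp \<rho> j - stamp \<rho> i \<in> J) i)"
    using bidefinable_freeze[OF bidefinable_until[OF bidefinable_const[OF one, of True]
          bidefinable_conj[OF bidefinable_closed[OF \<beta> one] lower]]] .
  moreover have "closed_definable (\<lambda>\<rho> i. next_at \<rho> (\<beta> \<rho>) (\<lambda>j. stamp \<rho> j - stamp \<rho> i \<notin> K) i)"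
    using bidefinable_freeze[OF bidefinable_next_at[OF upper \<beta>]] .
  moreover have "closed_definable (\<lambda>\<rho> i.
      (next_at \<rho> (gap_start \<rho> (\<beta> \<rho>)) ^^ Suc k) (\<lambda>m. stamp \<rho> m - stamp \<rho> i \<notin> J) i)" for k
    using bidefinable_freeze[OF bidefinable_next_at_funpow[OF bidefinable_not[OF lower] gap]] .
  \<comment> \<open>The preceding statement on the gap start is right-sided, this one on the gap end
    is left-sided; the common number \<open>k\<close> ties them to the same gap.\<close>
  moreover have "closed_definable (\<lambda>\<rho> i. (next_at \<rho> (gap_start \<rho> (\<beta> \<rho>)) ^^ Suc k)
      (next_at \<rho> (\<beta> \<rho>) (\<lambda>j. stamp \<rho> j - stamp \<rho> i \<notin> K)) i)" for k
    using bidefinable_freeze[OF bidefinable_next_at_funpow[OF bidefinable_next_at[OF upper \<beta>] gap]] .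
  ultimately have "closed_definable (\<lambda>\<rho> i. \<not>
    (\<not> until \<rho> (\<lambda>_. True) (\<lambda>j. \<beta> \<rho> j \<and> stamp \<rho> j - stamp \<rho> i \<in> J) i \<or>
     next_at \<rho> (\<beta> \<rho>) (\<lambda>j. stamp \<rho> j - stamp \<rho> i \<notin> K) i \<or>
     (\<exists>k\<le>l. (next_at \<rho> (gap_start \<rho> (\<beta> \<rho>)) ^^ Suc k) (\<lambda>m. stamp \<rho> m - stamp \<rho> i \<notin> J) i \<and>
           (next_at \<rho> (gap_start \<rho> (\<beta> \<rho>)) ^^ Suc k)
             (next_at \<rho> (\<beta> \<rho>) (\<lambda>j. stamp \<rho> j - stamp \<rho> i \<notin> K)) i)))"
    by (intro bidefinable_not bidefinable_disj bidefinable_ex_le bidefinable_conj)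
  then show ?thesis
  proof (rule bidefinable_cong)
    fix \<rho> :: "'a tword" and i
    assume \<rho>: "timed_word \<rho>"
    have "until \<rho> (\<lambda>_. True) (\<lambda>j. \<beta> \<rho> j \<and> stamp \<rho> j - stamp \<rho> i \<in> J) i \<longleftrightarrow>
        (\<exists>j\<in>positions \<rho>. i < j \<and> \<beta> \<rho> j \<and> stamp \<rho> j - stamp \<rho> i \<in> J)"
      by (simp add: until_def)
    with no_occurrence_iff[OF \<rho> J K \<open>l < u\<close>, of i "\<beta> \<rho>"]
    show "(\<not> (\<not> until \<rho> (\<lambda>_. True) (\<lambda>j. \<beta> \<rho> j \<and> stamp \<rho> j - stamp \<rho> i \<in> J) i \<or>
     next_at \<rho> (\<beta> \<rho>) (\<lambda>j. stamp \<rho> j - stamp \<rho> i \<notin> K) i \<or>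
     (\<exists>k\<le>l. (next_at \<rho> (gap_start \<rho> (\<beta> \<rho>)) ^^ Suc k) (\<lambda>m. stamp \<rho> m - stamp \<rho> i \<notin> J) i \<and>
           (next_at \<rho> (gap_start \<rho> (\<beta> \<rho>)) ^^ Suc k)
             (next_at \<rho> (\<beta> \<rho>) (\<lambda>j. stamp \<rho> j - stamp \<rho> i \<notin> K)) i))) \<longleftrightarrow>
      (\<exists>j\<in>positions \<rho>. i < j \<and> \<beta> \<rho> j \<and> stamp \<rho> j - stamp \<rho> i \<in> J \<inter> K)"
      by argo
  qed
qed

text \<open>The earlier of the two witnesses on the right serves on the left: a
  \<open>J\<close>-witness not after an occurrence in \<open>K\<close> lies in \<open>K\<close> by
  monotone stamps, and \<open>P\<close> holds all the way to an occurrence before the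
  \<open>J\<close>-witness.\<close>

lemma until_bounded_iff:
  assumes \<rho>: "timed_word \<rho>" and K: "K \<in> {{..u}, {..<u}}"
  shows "until \<rho> P (\<lambda>j. Q j \<and> stamp \<rho> j - t \<in> J \<inter> K) i \<longleftrightarrow>
    until \<rho> P (\<lambda>j. Q j \<and> stamp \<rho> j - t \<in> J) i \<and>
    (\<exists>j\<in>positions \<rho>. i < j \<and> Q j \<and> stamp \<rho> j - t \<in> J \<inter> K)" (is "?lhs \<longleftrightarrow> ?rhs")
proof
  assume ?rhs
  then obtain j m where j: "j \<in> positions \<rho>" "i < j" "\<And>k. i < k \<Longrightarrow> k < j \<Longrightarrow> P k"
      "Q j" "stamp \<rho> j - t \<in> J"
    and m: "m \<in> positions \<rho>" "i < m" "Q m" "stamp \<rho> m - t \<in> J \<inter> K"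
    unfolding until_def by metis
  show ?lhs
  proof (cases "j \<le> m")
    case True
    then have "stamp \<rho> j - t \<in> K"
      using stamp_mono[OF \<rho> m(1) True] m(4) K by auto
    then show ?thesis using j by (auto simp: until_def)
  next
    case False
    then show ?thesis using j m unfolding until_def by (metis less_trans not_le)
  qed
qed (auto simp: until_def)

text \<open>Bounded intervals with \<open>u\<close> at most \<open>l\<close> are empty or equal to
  \<open>[l,l]\<close>, and the latter is punctual.\<close>

lemma int_interval_cases:
  assumes "int_interval I" "\<not> punctual I"
  obtains (empty) "I = {}"
  | (unbounded) l :: nat where "I \<in> {{real l..}, {real l<..}}"
  | (bounded) J K and l u :: nat where "I = J \<inter> K" "l < u"
      "J \<in> {{real l..}, {real l<..}}" "K \<in> {{..real u}, {..<real u}}"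
proof -
  obtain l u :: nat where I: "I \<in> {{real l..real u}, {real l<..real u}, {real l..<real u},
      {real l<..<real u}, {real l..}, {real l<..}}"
    using assms(1) unfolding int_interval_def by blast
  show ?thesis
  proof (cases "I \<in> {{real l..}, {real l<..}}")
    case True
    then show ?thesis by (rule unbounded)
  next
    case False
    show ?thesis
    proof (cases "l < u")
      case True
      have "\<exists>J\<in>{{real l..}, {real l<..}}. \<exists>K\<in>{{..real u}, {..<real u}}. I = J \<inter> K"
        using I False
        by (auto simp: atLeastAtMost_def greaterThanAtMost_def atLeastLessThan_def
            greaterThanLessThan_def)
      then show ?thesis using bounded True by blast
    next
      case False
      have "I \<noteq> {real l..real l}" using assms(2) by (auto simp: punctual_def)
      then have "I = {}"
        using I False \<open>I \<notin> {{real l..}, {real l<..}}\<close> by (cases "l = u") auto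
      then show ?thesis by (rule empty)
    qed
  qed
qed

lemma mitl_sat_MUntil_until:
  "mitl_sat \<rho> i (MUntil \<psi>1 I \<psi>2) \<longleftrightarrow>
     until \<rho> (\<lambda>j. mitl_sat \<rho> j \<psi>1) (\<lambda>j. mitl_sat \<rho> j \<psi>2 \<and> stamp \<rho> j - stamp \<rho> i \<in> I) i"
  by (simp add: until_def)

text \<open>The induction carries formula and complement at every position, as MITL negation applies
  to all formulae and the target logic negates only atoms.\<close>

lemma mitl_closed_definable:
  assumes "mitl_formula \<psi>"
  shows "closed_definable (\<lambda>\<rho> i. mitl_sat \<rho> i \<psi>)"
  using assms
proof (induction \<psi>)
  case (MAtom a)
  then show ?case by (simp add: bidefinable_def definable_atom)
next
  case MTop
  then show ?case by (simp add: bidefinable_const)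
next
  case (MAnd \<psi>1 \<psi>2)
  then show ?case by (simp add: bidefinable_conj)
next
  case (MNot \<psi>)
  then show ?case by (simp add: bidefinable_not)
next
  case (MUntil \<psi>1 I \<psi>2)
  have IH: "closed_definable (\<lambda>\<rho> i. mitl_sat \<rho> i \<psi>1)" "closed_definable (\<lambda>\<rho> i. mitl_sat \<rho> i \<psi>2)"
    and I: "int_interval I" "\<not> punctual I"
    using MUntil by auto
  have one: "one_sided left_sided" "one_sided right_sided" by auto
  have until_lower: "closed_definable (\<lambda>\<rho> i. until \<rho> (\<lambda>j. mitl_sat \<rho> j \<psi>1)
      (\<lambda>j. mitl_sat \<rho> j \<psi>2 \<and> stamp \<rho> j - stamp \<rho> i \<in> J) i)"
    if "J \<in> {{real l..}, {real l<..}}" for J l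
    using bidefinable_freeze[OF bidefinable_until[OF bidefinable_closed[OF IH(1) one]
          bidefinable_conj[OF bidefinable_closed[OF IH(2) one] bidefinable_lower[OF that]]]] .
  from I show ?case
  proof (cases rule: int_interval_cases)
    case empty
    then show ?thesis by (simp add: bidefinable_const)
  next
    case (unbounded l)
    then show ?thesis
      unfolding mitl_sat_MUntil_until by (rule until_lower)
  next
    case (bounded J K l u)
    show ?thesis
      unfolding mitl_sat_MUntil_until bounded(1)
      by (rule bidefinable_cong[OF bidefinable_conj[OF until_lower[OF bounded(3)]
            closed_definable_eventually[OF IH(2) bounded(3,4,2)]]])
        (simp only: until_bounded_iff[OF _ bounded(4)])
  qed
qed

lemma mitl_to_one_tptl_0_inf:
  assumes "mitl_formula \<psi>"
  shows "\<exists>\<phi>. tptl_closed \<phi> \<and> one_tptl_0_inf \<phi> \<and> tptl_lang \<phi> = mitl_lang \<psi>"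
proof -
  have "definable (\<lambda>_. False) (\<lambda>\<rho> i t. mitl_sat \<rho> i \<psi>)"
    using mitl_closed_definable[OF assms] by (simp add: bidefinable_def)
  then obtain \<phi> where \<phi>: "tptl_vars \<phi> \<subseteq> {0}" "\<forall>(x, I)\<in>open_constrs \<phi>. False" "tptl_0_inf \<phi>"
    "\<And>\<rho> i \<nu>. timed_word \<rho> \<Longrightarrow> i \<in> positions \<rho> \<Longrightarrow> \<nu> 0 \<le> stamp \<rho> i \<Longrightarrow>
       tptl_sat \<rho> i \<nu> \<phi> \<longleftrightarrow> mitl_sat \<rho> i \<psi>"
    unfolding definable_def expresses_def by blast
  \<comment> \<open>The initial valuation 0 is admissible because time stamps are
    nonnegative.\<close>
  have "tptl_sat \<rho> 0 (\<lambda>_. 0) \<phi> \<longleftrightarrow> mitl_sat \<rho> 0 \<psi>" if "timed_word \<rho>" for \<rho>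
    using that by (intro \<phi>(4)) (auto simp: timed_word_def)
  then have "tptl_lang \<phi> = mitl_lang \<psi>"
    by (auto simp: tptl_lang_def mitl_lang_def)
  then show ?thesis
    using \<phi>(1-3) unfolding tptl_closed_def one_tptl_0_inf_def by blast
qed

section \<open>A formula without MITL equivalent\<close>

definition uniform_word :: "'a \<Rightarrow> real \<Rightarrow> 'a tword" where
  "uniform_word b d = InfW (\<lambda>n. (b, real n * d))"

lemma uniform_word_simps [simp]:
  "positions (uniform_word b d) = UNIV"
  "letter (uniform_word b d) n = b"
  "stamp (uniform_word b d) n = real n * d"
  by (auto simp: uniform_word_def letter_def stamp_def)

lemma timed_word_uniform:
  assumes "0 < d"
  shows "timed_word (uniform_word b d)"
  using assms reals_Archimedean3[OF assms]
  by (auto simp: timed_word_def intro!: mult_right_mono)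

text \<open>Steps shorter than 1 cannot jump over an open unit interval.\<close>

lemma multiple_in_unit_interval:
  fixes d :: real
  assumes "0 < d" "d < 1"
  shows "\<exists>n>0. real n * d \<in> {real l<..<real l + 1}"
proof -
  \<comment> \<open>\<open>m * d\<close> is the last multiple not exceeding \<open>l\<close>, so the
    next one is the witness.\<close>
  define m where "m = nat \<lfloor>real l / d\<rfloor>"
  have "real m \<le> real l / d" "real l / d < real m + 1"
    unfolding m_def using assms by (auto simp: of_nat_nat)
  then have "real m * d \<le> real l" "real l < (real m + 1) * d"
    using assms by (auto simp: field_simps)
  then have "real (Suc m) * d \<in> {real l<..<real l + 1}"
    using assms by (auto simp: algebra_simps)
  then show ?thesis by blast
qed

text \<open>A nonempty non-punctual interval with integer endpoints contains some open interval
  \<open>(l, l + 1)\<close>, which a multiple of \<open>d\<close> must hit.\<close>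

lemma int_interval_multiple:
  assumes "int_interval I" "\<not> punctual I" "0 < d" "d < 1"
  shows "(\<exists>n>0. real n * d \<in> I) \<longleftrightarrow> I \<noteq> {}"
  using assms(1,2)
proof (cases rule: int_interval_cases)
  case (unbounded l)
  then have "{real l<..<real l + 1} \<subseteq> I" by auto
  then show ?thesis using multiple_in_unit_interval[OF assms(3,4), of l] by blast
next
  case (bounded J K l u)
  have "real l + 1 \<le> real u" using bounded(2) by linarith
  then have "{real l<..<real l + 1} \<subseteq> I" using bounded by auto
  then show ?thesis using multiple_in_unit_interval[OF assms(3,4), of l] by blast
qed simp

text \<open>No integer lies strictly between 0 and 1, so \<open>I\<close> contains all of that open
  interval or none of it.\<close>

lemma int_interval_fraction:
  assumes "int_interval I" "0 < d" "d < 1" "0 < e" "e < 1"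
  shows "d \<in> I \<longleftrightarrow> e \<in> I"
proof -
  have lower: "real l \<le> c \<longleftrightarrow> l = 0" "real l < c \<longleftrightarrow> l = 0" if "0 < c" "c < 1" for l c
    using that by (cases l; simp)+
  have upper: "c \<le> real u \<longleftrightarrow> u \<noteq> 0" "c < real u \<longleftrightarrow> u \<noteq> 0" if "0 < c" "c < 1" for u c
    using that by (cases u; simp)+
  show ?thesis
    using assms(1) unfolding int_interval_def by (auto simp: lower upper assms less_imp_le)
qed

text \<open>Truth values are constant along each word, so an until reduces to asking which multiples
  of the spacing lie in \<open>I\<close>; the answer is the same for all spacings below 1.\<close>

lemma mitl_sat_uniform_word:
  assumes "mitl_formula \<psi>" "0 < d" "d < 1" "0 < e" "e < 1"
  shows "mitl_sat (uniform_word b d) i \<psi> \<longleftrightarrow> mitl_sat (uniform_word b e) i' \<psi>"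
  using assms
proof (induction \<psi> arbitrary: d e i i')
  case (MUntil \<psi>1 I \<psi>2)
  \<comment> \<open>By induction each argument has a single truth value on all uniform words of
    spacing below 1, at all positions; spacing 1/2 and position 0 serve as reference.\<close>
  define p1 p2 where "p1 \<longleftrightarrow> mitl_sat (uniform_word b (1/2)) 0 \<psi>1"
    and "p2 \<longleftrightarrow> mitl_sat (uniform_word b (1/2)) 0 \<psi>2"
  have I: "int_interval I" "\<not> punctual I" using MUntil.prems by auto
  have sat: "mitl_sat (uniform_word b c) i (MUntil \<psi>1 I \<psi>2) \<longleftrightarrow>
      p2 \<and> (if p1 then I \<noteq> {} else 1/2 \<in> I)" if c: "0 < c" "c < 1" for c i
  proof -
    have p: "mitl_sat (uniform_word b c) j \<psi>1 \<longleftrightarrow> p1" "mitl_sat (uniform_word b c) j \<psi>2 \<longleftrightarrow> p2" for j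
      unfolding p1_def p2_def
      using MUntil.IH(1)[of c "1/2" j 0] MUntil.IH(2)[of c "1/2" j 0] MUntil.prems(1) c by auto
    have "mitl_sat (uniform_word b c) i (MUntil \<psi>1 I \<psi>2) \<longleftrightarrow>
        (\<exists>j>i. p2 \<and> real j * c - real i * c \<in> I \<and> (\<forall>k. i < k \<and> k < j \<longrightarrow> p1))"
      by (simp add: p)
    \<comment> \<open>Here \<open>n = j - i\<close>. If \<open>p1\<close> fails, no position may lie
      strictly between \<open>i\<close> and \<open>j\<close>, so only the immediate successor
      remains.\<close>
    also have "\<dots> \<longleftrightarrow> (\<exists>n>0. p2 \<and> real n * c \<in> I \<and> (p1 \<or> n = 1))"
    proof safe
      fix j assume "i < j" "real j * c - real i * c \<in> I" "p2" "\<forall>k. i < k \<and> k < j \<longrightarrow> p1"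
      moreover have "real (j - i) * c = real j * c - real i * c"
        using \<open>i < j\<close> by (simp add: of_nat_diff algebra_simps)
      moreover have "p1 \<or> j - i = 1"
        using \<open>\<forall>k. i < k \<and> k < j \<longrightarrow> p1\<close> \<open>i < j\<close> by (cases "j = Suc i") (auto dest: spec[of _ "Suc i"])
      ultimately show "\<exists>n>0. p2 \<and> real n * c \<in> I \<and> (p1 \<or> n = 1)"
        by (intro exI[of _ "j - i"]) auto
    next
      fix n :: nat assume "0 < n" "p2" "real n * c \<in> I" "p1"
      then show "\<exists>j>i. p2 \<and> real j * c - real i * c \<in> I \<and> (\<forall>k. i < k \<and> k < j \<longrightarrow> p1)"
        by (intro exI[of _ "i + n"]) (simp add: algebra_simps)
    next
      assume "p2" "real 1 * c \<in> I"
      then show "\<exists>j>i. p2 \<and> real j * c - real i * c \<in> I \<and> (\<forall>k. i < k \<and> k < j \<longrightarrow> p1)"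
        by (intro exI[of _ "i + 1"]) (auto simp: algebra_simps)
    qed
    also have "\<dots> \<longleftrightarrow> p2 \<and> (if p1 then \<exists>n>0. real n * c \<in> I else c \<in> I)"
      by auto
    also have "\<dots> \<longleftrightarrow> p2 \<and> (if p1 then I \<noteq> {} else 1/2 \<in> I)"
      using int_interval_multiple[OF I c] int_interval_fraction[OF I(1) c, of "1/2"] by simp
    finally show ?thesis .
  qed
  show ?case
    unfolding sat[OF MUntil.prems(2,3)] sat[OF MUntil.prems(4,5)] ..
next
  case (MAnd \<psi>1 \<psi>2)
  show ?case
    using MAnd.IH(1)[of d e i i'] MAnd.IH(2)[of d e i i'] MAnd.prems by simp
next
  case (MNot \<psi>)
  show ?case
    using MNot.IH[of d e i i'] MNot.prems by simp
qed simp_all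

section \<open>The separating formula\<close>

definition two_within_one :: "'a \<Rightarrow> var \<Rightarrow> 'a tptl" where
  "two_within_one b x = Freeze x (TEv (TAnd (TAtom b) (TEv (TAnd (TAtom b) (Constr x {0..1})))))"

lemma right_sided_unit: "right_sided {0..1}"
  unfolding right_sided_def by (rule exI[of _ 1]) simp

lemma two_within_one_closed: "tptl_closed (two_within_one b x)"
  by (auto simp: two_within_one_def TEv_def tptl_closed_def)

lemma two_within_one_one_tptl_0_inf: "one_tptl_0_inf (two_within_one b x)"
  using right_sided_unit
  by (auto simp: two_within_one_def TEv_def one_tptl_0_inf_def tptl_0_inf_def type_le_def)

lemma uniform_word_in_two_within_one:
  assumes "0 < d"
  shows "uniform_word b d \<in> tptl_lang (two_within_one b x) \<longleftrightarrow> d \<le> 1/2"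
proof -
  have "uniform_word b d \<in> tptl_lang (two_within_one b x) \<longleftrightarrow>
      (\<exists>j>0. \<exists>k>j. real k * d \<le> 1)"
    using assms by (simp add: tptl_lang_def two_within_one_def TEv_def timed_word_uniform)
  also have "\<dots> \<longleftrightarrow> d \<le> 1/2"
  proof
    assume "\<exists>j>0. \<exists>k>j. real k * d \<le> 1"
    then obtain j k :: nat where "0 < j" "j < k" and k1: "real k * d \<le> 1"
      by blast
    then have "2 \<le> k" by simp
    have "2 * d \<le> real k * d"
      using \<open>2 \<le> k\<close> assms by (intro mult_right_mono) auto
    then show "d \<le> 1/2" using k1 by simp
  next
    assume "d \<le> 1/2"
    then have "(0::nat) < 1 \<and> (1::nat) < 2 \<and> real 2 * d \<le> 1" by simp
    then show "\<exists>j>0. \<exists>k>j. real k * d \<le> 1" by blast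
  qed
  finally show ?thesis .
qed

text \<open>The spacings 1/2 and 2/3 are both below 1, hence indistinguishable in MITL, but only the
  first meets the bound 1/2.\<close>

lemma two_within_one_not_mitl:
  assumes "mitl_formula \<psi>"
  shows "mitl_lang \<psi> \<noteq> tptl_lang (two_within_one b x)"
proof
  assume eq: "mitl_lang \<psi> = tptl_lang (two_within_one b x)"
  have "uniform_word b (1/2) \<in> mitl_lang \<psi> \<longleftrightarrow> uniform_word b (2/3) \<in> mitl_lang \<psi>"
    using mitl_sat_uniform_word[OF assms, of "1/2" "2/3" b 0 0]
    by (simp add: mitl_lang_def timed_word_uniform)
  then show False
    by (simp add: eq uniform_word_in_two_within_one)
qed

theorem theorem16:
  shows "(\<forall>\<psi> :: 'a::finite mitl. mitl_formula \<psi> \<longrightarrow>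
            (\<exists>\<phi>. tptl_closed \<phi> \<and> one_tptl_0_inf \<phi> \<and> tptl_lang \<phi> = mitl_lang \<psi>)) \<and>
         (\<exists>\<phi> :: 'a tptl. tptl_closed \<phi> \<and> one_tptl_0_inf \<phi> \<and>
            \<not> (\<exists>\<psi>. mitl_formula \<psi> \<and> mitl_lang \<psi> = tptl_lang \<phi>)) \<and>
         (\<forall>(b :: 'a) x \<phi>.
            \<phi> = Freeze x (TEv (TAnd (TAtom b) (TEv (TAnd (TAtom b) (Constr x {0..1}))))) \<longrightarrow>
            tptl_closed \<phi> \<and> one_tptl_0_inf \<phi> \<and>
            \<not> (\<exists>\<psi>. mitl_formula \<psi> \<and> mitl_lang \<psi> = tptl_lang \<phi>))"
proof (intro conjI allI impI)
  show "\<exists>\<phi>. tptl_closed \<phi> \<and> one_tptl_0_inf \<phi> \<and> tptl_lang \<phi> = mitl_lang \<psi>"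
    if "mitl_formula \<psi>" for \<psi> :: "'a mitl"
    using that by (rule mitl_to_one_tptl_0_inf)
  show "\<exists>\<phi> :: 'a tptl. tptl_closed \<phi> \<and> one_tptl_0_inf \<phi> \<and>
      \<not> (\<exists>\<psi>. mitl_formula \<psi> \<and> mitl_lang \<psi> = tptl_lang \<phi>)"
    by (rule exI[of _ "two_within_one undefined 0"])
      (simp add: two_within_one_closed two_within_one_one_tptl_0_inf two_within_one_not_mitl)
  fix b :: 'a and x and \<phi> :: "'a tptl"
  assume "\<phi> = Freeze x (TEv (TAnd (TAtom b) (TEv (TAnd (TAtom b) (Constr x {0..1})))))"
  then have \<phi>: "\<phi> = two_within_one b x"
    by (simp add: two_within_one_def)
  show "tptl_closed \<phi>"
    unfolding \<phi> by (rule two_within_one_closed)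
  show "one_tptl_0_inf \<phi>"
    unfolding \<phi> by (rule two_within_one_one_tptl_0_inf)
  show "\<not> (\<exists>\<psi>. mitl_formula \<psi> \<and> mitl_lang \<psi> = tptl_lang \<phi>)"
    by (simp add: \<phi> two_within_one_not_mitl)
qed

end
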